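(* Let $L$ be either $L_F$ (intuitionistic case) or $L_V$ (interval-valued case), and let $P$ be an ifDATALOG program over $L$. Then both consequence transformations $iDT_P$ and $iNT_P$ have a fixed point, denoted by $\mathrm{lfp}(iDT_P)$ and $\mathrm{lfp}(iNT_P)$ respectively. If $P$ is positive (contains no negation), then $\mathrm{lfp}(iDT_P)=\mathrm{lfp}(iNT_P)$ and this is the least fixed point. Both $\mathrm{lfp}(iDT_P)$ and $\mathrm{lfp}(iNT_P)$ are models of $P$; if $P$ is negation-free, this is the least model of $P$.
   Context: Lattices. $L_F=\{(x_1,x_2)\in[0,1]^2 : x_1+x_2\le 1\}$ with $(x_1,x_2)\le_F(y_1,y_2)\iff x_1\le y_1,\ x_2\ge y_2$, least element $\vec 0_F=(0,1)$, greatest element $\vec 1_F=(1,0)$. $L_V=\{(x_1,x_2)\in[0,1]^2 : x_1\le x_2\}$ with $(x_1,x_2)\le_V(y_1,y_2)\iff x_1\le y_1,\ x_2\le y_2$, least element $\vec 0_V=(0,0)$, greatest element $\vec 1_V=(1,1)$. Both are complete lattices. Write $L$ with order $\le$, least element $\vec 0$, greatest element $\vec 1$ for either one. Conjunction is the lattice minimum (meet), disjunction the lattice maximum (join); negation is the standard one, $\neg(x_1,x_2)=(x_2,x_1)$ on $L_F$ and $\neg(x_1,x_2)=(1-x_2,1-x_1)$ on $L_V$. An implication operator $\vec I$ on $L$ is a map $L\times L\to L$ that is decreasing in its first and increasing in its second argument, with $\vec I(\vec 0,\vec 0)=\vec I(\vec 0,\vec 1)=\vec I(\vec 1,\vec 1)=\vec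 1$ and $\vec I(\vec 1,\vec 0)=\vec 0$. Programs. Terms are variables or constants (no function symbols). An atom is $p(t_1,\dots,t_n)$ with $p$ a predicate symbol and $t_i$ terms; a literal is an atom or a negated atom. An ifDATALOG rule is a triple $(r;\vec\beta;\vec I)$ where $r$ has the form $A\leftarrow A_1,\dots,A_n$ ($n\ge 0$), $A$ is an atom (the head), $A_1,\dots,A_n$ are literals (the body), $\vec\beta\in L$, $\vec\beta\neq\vec 0$, is its level and $\vec I$ is an implication operator on $L$. Rules with $n=0$ are facts (with body level $\vec 1$). A rule is safe if every variable in the head occurs in the body and every variable occurring in a negative literal also occurs in a positive literal of the body. An ifDATALOG program is a finite set of safe ifDATALOG rules. The Herbrand universe $H_P$ is the set of constants of $P$; the Herbrand base $B_P$ is the set of ground atoms with predicate symbols of $P$ and arguments in $H_P$; $\mathrm{ground}(P)$ is the set of all rules obtained from rules of $P$ by replacing variables with elements of $H_P$. Interpretations. An interpretation is an $L$-valued fuzzy set over $B_P$, i.e. a map $A\mapsto\vec\alpha_A\in L$, written as a set of pairs $(A,\vec\alpha_A)$; atoms not listed have level $\vec 0$. Interpretations are ordered pointwise and union is pointwise join; they form a complete lattice. For a literal $A_i$, $|A_i|$ denotes the atom underlying it. In an interpretation $X$, the body level of a ground rule is $\vec\alpha_{body}=\min(\vec\alpha_{A_1},\dots,\vec\alpha_{A_n})$, with $\vec\alpha_{\neg B}=\neg\vec\alpha_B$, if all atoms $|A_i|$ occur in $X$ (have level $\ne\vec 0$), and $\vec\alpha_{body}=\vec 0$ if some $|A_i|$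 does not occur in $X$. An interpretation is a model of $P$ if $\vec I(\vec\alpha_{body},\vec\alpha_A)\ge\vec\beta$ for every $(A\leftarrow A_1,\dots,A_n;\vec\beta;\vec I)\in\mathrm{ground}(P)$. A model $M$ is least if $M\le N$ for every model $N$. Transformations. For a rule $R_A=(A\leftarrow A_1,\dots,A_n;\vec\beta;\vec I)\in\mathrm{ground}(P)$ all of whose atoms $|A_i|$ occur in $X$, put $\vec\alpha_A=\max(\vec 0,\min\{\vec\gamma\in L : \vec I(\vec\alpha_{body},\vec\gamma)\ge\vec\beta\})$; here $\min$ is the least element of the set, and the implication operators used are those for which it exists (i.e. for which the uncertainty-level function $f(\vec I,\vec\alpha,\vec\beta)=\min\{\vec\gamma : \vec I(\vec\alpha,\vec\gamma)\ge\vec\beta\}$ is defined). The deterministic transformation is $iDT_P(X)=\bigcup_{R_A}\{(A,\vec\alpha_A)\}\cup X$, the union over all such rules in $\mathrm{ground}(P)$ evaluated in parallel. The nondeterministic transformation is $iNT_P(X)=\{(A,\vec\alpha_A)\}\cup X$ for one such rule $R_A$; rules are considered independently and sequentially, and $X$ is a fixed point of $iNT_P$ if $iNT_P(X)=X$ for every choice of the rule. $\mathrm{lfp}(iDT_P)$ and $\mathrm{lfp}(iNT_P)$ denote the (inflationary) fixed points reached by iterating the transformation starting from the set of facts (taking unions at limit stages). *)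

theory Defs
  imports Complex_Main
begin

typedef L_F = "{(x1 :: real, x2 :: real). x1 \<in> {0..1} \<and> x2 \<in> {0..1} \<and> x1 + x2 \<le> 1}"
  by (rule exI[of _ "(0, 1)"]) simp

typedef L_V = "{(x1 :: real, x2 :: real). x1 \<in> {0..1} \<and> x2 \<in> {0..1} \<and> x1 \<le> x2}"
  by (rule exI[of _ "(0, 1)"]) simp

setup_lifting type_definition_L_F
setup_lifting type_definition_L_V

text \<open>On both types, unary minus is the standard negation of the uncertainty levels.\<close>

instantiation L_F :: "{complete_lattice, uminus}"
begin

lift_definition less_eq_L_F :: "L_F \<Rightarrow> L_F \<Rightarrow> bool"
  is "\<lambda>x y. fst x \<le> fst y \<and> snd x \<ge> snd y" .

definition less_L_F :: "L_F \<Rightarrow> L_F \<Rightarrow> bool" where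
  "less_L_F x y \<longleftrightarrow> x \<le> y \<and> \<not> y \<le> x"

lift_definition bot_L_F :: L_F is "(0, 1)" by simp

lift_definition top_L_F :: L_F is "(1, 0)" by simp

lift_definition inf_L_F :: "L_F \<Rightarrow> L_F \<Rightarrow> L_F"
  is "\<lambda>x y. (min (fst x) (fst y), max (snd x) (snd y))" by auto

lift_definition sup_L_F :: "L_F \<Rightarrow> L_F \<Rightarrow> L_F"
  is "\<lambda>x y. (max (fst x) (fst y), min (snd x) (snd y))" by auto

lift_definition Inf_L_F :: "L_F set \<Rightarrow> L_F"
  is "\<lambda>A. if A = {} then (1, 0) else (Inf (fst ` A), Sup (snd ` A))"
proof -
  fix A :: "(real \<times> real) set"
  assume A: "\<And>x. x \<in> A \<Longrightarrow> x \<in> {(x1, x2). x1 \<in> {0..1} \<and> x2 \<in> {0..1} \<and> x1 + x2 \<le> 1}"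
  show "?thesis A"
  proof (cases "A = {}")
    case False
    then obtain a where a: "a \<in> A" by auto
    have bb: "bdd_below (fst ` A)" "bdd_above (snd ` A)"
      using A by (auto intro!: bdd_belowI2[of _ 0] bdd_aboveI2[of _ _ 1])
    have f: "0 \<le> Inf (fst ` A)" using A False by (intro cInf_greatest) auto
    have "Inf (fst ` A) \<le> fst a" using a bb by (intro cInf_lower) auto
    then have f1: "Inf (fst ` A) \<le> 1" using A[OF a] by auto
    have "snd a \<le> Sup (snd ` A)" using a bb by (intro cSup_upper) auto
    then have s: "0 \<le> Sup (snd ` A)" using A[OF a] by auto
    have fs: "Sup (snd ` A) \<le> 1 - Inf (fst ` A)"
    proof (rule cSup_least)
      fix z assume "z \<in> snd ` A"
      then obtain x where x: "x \<in> A" "z = snd x" by auto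
      have "Inf (fst ` A) \<le> fst x" using x bb by (intro cInf_lower) auto
      then show "z \<le> 1 - Inf (fst ` A)" using A[OF x(1)] x(2) by (auto simp: case_prod_beta)
    qed (use False in auto)
    show ?thesis using False f f1 s fs by auto
  qed auto
qed

lift_definition Sup_L_F :: "L_F set \<Rightarrow> L_F"
  is "\<lambda>A. if A = {} then (0, 1) else (Sup (fst ` A), Inf (snd ` A))"
proof -
  fix A :: "(real \<times> real) set"
  assume A: "\<And>x. x \<in> A \<Longrightarrow> x \<in> {(x1, x2). x1 \<in> {0..1} \<and> x2 \<in> {0..1} \<and> x1 + x2 \<le> 1}"
  show "?thesis A"
  proof (cases "A = {}")
    case False
    then obtain a where a: "a \<in> A" by auto
    have bb: "bdd_below (snd ` A)" "bdd_above (fst ` A)"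
      using A by (auto intro!: bdd_belowI2[of _ 0] bdd_aboveI2[of _ _ 1])
    have f: "0 \<le> Inf (snd ` A)" using A False by (intro cInf_greatest) auto
    have "Inf (snd ` A) \<le> snd a" using a bb by (intro cInf_lower) auto
    then have f1: "Inf (snd ` A) \<le> 1" using A[OF a] by auto
    have "fst a \<le> Sup (fst ` A)" using a bb by (intro cSup_upper) auto
    then have s: "0 \<le> Sup (fst ` A)" using A[OF a] by auto
    have fs: "Sup (fst ` A) \<le> 1 - Inf (snd ` A)"
    proof (rule cSup_least)
      fix z assume "z \<in> fst ` A"
      then obtain x where x: "x \<in> A" "z = fst x" by auto
      have "Inf (snd ` A) \<le> snd x" using x bb by (intro cInf_lower) auto
      then show "z \<le> 1 - Inf (snd ` A)" using A[OF x(1)] x(2) by (auto simp: case_prod_beta)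
    qed (use False in auto)
    show ?thesis using False f f1 s fs by auto
  qed auto
qed

lift_definition uminus_L_F :: "L_F \<Rightarrow> L_F" is "\<lambda>x. (snd x, fst x)" by auto

instance
proof
  fix x y z :: L_F and A :: "L_F set"
  show "(x < y) = (x \<le> y \<and> \<not> y \<le> x)" by (simp add: less_L_F_def)
  show "x \<le> x" by transfer simp
  show "x \<le> y \<Longrightarrow> y \<le> z \<Longrightarrow> x \<le> z" by transfer auto
  show "x \<le> y \<Longrightarrow> y \<le> x \<Longrightarrow> x = y" by transfer auto
  show "inf x y \<le> x" "inf x y \<le> y" by (transfer, simp)+
  show "x \<le> y \<Longrightarrow> x \<le> z \<Longrightarrow> x \<le> inf y z" by transfer simp
  show "x \<le> sup x y" "y \<le> sup x y" by (transfer, simp)+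
  show "y \<le> x \<Longrightarrow> z \<le> x \<Longrightarrow> sup y z \<le> x" by transfer simp
  show "Inf {} = (top :: L_F)" "Sup {} = (bot :: L_F)" by (transfer, simp)+
  show "x \<in> A \<Longrightarrow> Inf A \<le> x"
    by transfer (auto simp: Ball_def intro!: cInf_lower cSup_upper
        bdd_belowI2[of _ 0] bdd_aboveI2[of _ _ 1])
  show "x \<in> A \<Longrightarrow> x \<le> Sup A"
    by transfer (auto simp: Ball_def intro!: cInf_lower cSup_upper
        bdd_belowI2[of _ 0] bdd_aboveI2[of _ _ 1])
  show "(\<And>x. x \<in> A \<Longrightarrow> z \<le> x) \<Longrightarrow> z \<le> Inf A"
    by transfer (auto simp: Ball_def intro!: cInf_greatest cSup_least)
  show "(\<And>x. x \<in> A \<Longrightarrow> x \<le> z) \<Longrightarrow> Sup A \<le> z"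
    by transfer (auto simp: Ball_def intro!: cInf_greatest cSup_least)
qed

end

instantiation L_V :: "{complete_lattice, uminus}"
begin

lift_definition less_eq_L_V :: "L_V \<Rightarrow> L_V \<Rightarrow> bool"
  is "\<lambda>x y. fst x \<le> fst y \<and> snd x \<le> snd y" .

definition less_L_V :: "L_V \<Rightarrow> L_V \<Rightarrow> bool" where
  "less_L_V x y \<longleftrightarrow> x \<le> y \<and> \<not> y \<le> x"

lift_definition bot_L_V :: L_V is "(0, 0)" by simp

lift_definition top_L_V :: L_V is "(1, 1)" by simp

lift_definition inf_L_V :: "L_V \<Rightarrow> L_V \<Rightarrow> L_V"
  is "\<lambda>x y. (min (fst x) (fst y), min (snd x) (snd y))" by auto

lift_definition sup_L_V :: "L_V \<Rightarrow> L_V \<Rightarrow> L_V"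
  is "\<lambda>x y. (max (fst x) (fst y), max (snd x) (snd y))" by auto

lift_definition Inf_L_V :: "L_V set \<Rightarrow> L_V"
  is "\<lambda>A. if A = {} then (1, 1) else (Inf (fst ` A), Inf (snd ` A))"
proof -
  fix A :: "(real \<times> real) set"
  assume A: "\<And>x. x \<in> A \<Longrightarrow> x \<in> {(x1, x2). x1 \<in> {0..1} \<and> x2 \<in> {0..1} \<and> x1 \<le> x2}"
  show "?thesis A"
  proof (cases "A = {}")
    case False
    then obtain a where a: "a \<in> A" by auto
    have bb: "bdd_below (fst ` A)" "bdd_below (snd ` A)"
      using A by (auto intro!: bdd_belowI2[of _ 0])
    have f: "0 \<le> Inf (fst ` A)" using A False by (intro cInf_greatest) auto
    have "Inf (snd ` A) \<le> snd a" using a bb by (intro cInf_lower) auto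
    then have s: "Inf (snd ` A) \<le> 1" using A[OF a] by auto
    have fs: "Inf (fst ` A) \<le> Inf (snd ` A)"
    proof (rule cInf_greatest)
      fix z assume "z \<in> snd ` A"
      then obtain x where x: "x \<in> A" "z = snd x" by auto
      have "Inf (fst ` A) \<le> fst x" using x bb by (intro cInf_lower) auto
      then show "Inf (fst ` A) \<le> z" using A[OF x(1)] x(2) by (auto simp: case_prod_beta)
    qed (use False in auto)
    show ?thesis using False f s fs by auto
  qed auto
qed

lift_definition Sup_L_V :: "L_V set \<Rightarrow> L_V"
  is "\<lambda>A. if A = {} then (0, 0) else (Sup (fst ` A), Sup (snd ` A))"
proof -
  fix A :: "(real \<times> real) set"
  assume A: "\<And>x. x \<in> A \<Longrightarrow> x \<in> {(x1, x2). x1 \<in> {0..1} \<and> x2 \<in> {0..1} \<and> x1 \<le> x2}"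
  show "?thesis A"
  proof (cases "A = {}")
    case False
    then obtain a where a: "a \<in> A" by auto
    have bb: "bdd_above (fst ` A)" "bdd_above (snd ` A)"
      using A by (auto intro!: bdd_aboveI2[of _ _ 1])
    have f: "Sup (snd ` A) \<le> 1" using A False by (intro cSup_least) auto
    have "fst a \<le> Sup (fst ` A)" using a bb by (intro cSup_upper) auto
    then have s: "0 \<le> Sup (fst ` A)" using A[OF a] by auto
    have fs: "Sup (fst ` A) \<le> Sup (snd ` A)"
    proof (rule cSup_least)
      fix z assume "z \<in> fst ` A"
      then obtain x where x: "x \<in> A" "z = fst x" by auto
      have "snd x \<le> Sup (snd ` A)" using x bb by (intro cSup_upper) auto
      then show "z \<le> Sup (snd ` A)" using A[OF x(1)] x(2) by (auto simp: case_prod_beta)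
    qed (use False in auto)
    show ?thesis using False f s fs by auto
  qed auto
qed

lift_definition uminus_L_V :: "L_V \<Rightarrow> L_V" is "\<lambda>x. (1 - snd x, 1 - fst x)" by auto

instance
proof
  fix x y z :: L_V and A :: "L_V set"
  show "(x < y) = (x \<le> y \<and> \<not> y \<le> x)" by (simp add: less_L_V_def)
  show "x \<le> x" by transfer simp
  show "x \<le> y \<Longrightarrow> y \<le> z \<Longrightarrow> x \<le> z" by transfer auto
  show "x \<le> y \<Longrightarrow> y \<le> x \<Longrightarrow> x = y" by transfer auto
  show "inf x y \<le> x" "inf x y \<le> y" by (transfer, simp)+
  show "x \<le> y \<Longrightarrow> x \<le> z \<Longrightarrow> x \<le> inf y z" by transfer simp
  show "x \<le> sup x y" "y \<le> sup x y" by (transfer, simp)+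
  show "y \<le> x \<Longrightarrow> z \<le> x \<Longrightarrow> sup y z \<le> x" by transfer simp
  show "Inf {} = (top :: L_V)" "Sup {} = (bot :: L_V)" by (transfer, simp)+
  show "x \<in> A \<Longrightarrow> Inf A \<le> x"
    by transfer (auto simp: Ball_def intro!: cInf_lower bdd_belowI2[of _ 0])
  show "x \<in> A \<Longrightarrow> x \<le> Sup A"
    by transfer (auto simp: Ball_def intro!: cSup_upper bdd_aboveI2[of _ _ 1])
  show "(\<And>x. x \<in> A \<Longrightarrow> z \<le> x) \<Longrightarrow> z \<le> Inf A"
    by transfer (auto simp: Ball_def intro!: cInf_greatest)
  show "(\<And>x. x \<in> A \<Longrightarrow> x \<le> z) \<Longrightarrow> Sup A \<le> z"
    by transfer (auto simp: Ball_def intro!: cSup_least)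
qed

end


definition implication_operator :: "('l::complete_lattice \<Rightarrow> 'l \<Rightarrow> 'l) \<Rightarrow> bool" where
  "implication_operator I \<longleftrightarrow>
     (\<forall>x x' y. x \<le> x' \<longrightarrow> I x' y \<le> I x y) \<and>
     (\<forall>x y y'. y \<le> y' \<longrightarrow> I x y \<le> I x y') \<and>
     I bot bot = top \<and> I bot top = top \<and> I top top = top \<and> I top bot = bot"

definition is_least :: "('a::order) set \<Rightarrow> 'a \<Rightarrow> bool" where
  "is_least S m \<longleftrightarrow> m \<in> S \<and> (\<forall>s\<in>S. m \<le> s)"

definition uncertainty_level_defined :: "('l::complete_lattice \<Rightarrow> 'l \<Rightarrow> 'l) \<Rightarrow> bool" where
  "uncertainty_level_defined I \<longleftrightarrow> (\<forall>\<alpha> \<beta>. \<exists>m. is_least {\<gamma>. \<beta> \<le> I \<alpha> \<gamma>} m)"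

text \<open>Meaningful only where the least element exists.\<close>

definition uncertainty_level :: "('l::complete_lattice \<Rightarrow> 'l \<Rightarrow> 'l) \<Rightarrow> 'l \<Rightarrow> 'l \<Rightarrow> 'l" where
  "uncertainty_level I \<alpha> \<beta> = (LEAST \<gamma>. \<beta> \<le> I \<alpha> \<gamma>)"


datatype ('c, 'v) trm = Const 'c | Var 'v

datatype ('p, 't) atom = Atom (pred: 'p) (args: "'t list")

datatype 'a literal = Pos (atom_of: 'a) | Neg (atom_of: 'a)

text \<open>A rule is parametric in the type of atoms, so that it may be ground or not.\<close>

datatype ('a, 'l) rule =
  Rule (head: 'a) (body: "'a literal list") (level: 'l) (impl: "'l \<Rightarrow> 'l \<Rightarrow> 'l")

type_synonym ('p, 'c, 'v, 'l) program = "(('p, ('c, 'v) trm) atom, 'l) rule set"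
type_synonym ('p, 'c, 'l) ground_rule = "(('p, 'c) atom, 'l) rule"

definition atom_vars :: "('p, ('c, 'v) trm) atom \<Rightarrow> 'v set" where
  "atom_vars A = {v. Var v \<in> set (args A)}"

definition rule_atoms :: "('a, 'l) rule \<Rightarrow> 'a set" where
  "rule_atoms R = insert (head R) (atom_of ` set (body R))"

definition safe :: "(('p, ('c, 'v) trm) atom, 'l) rule \<Rightarrow> bool" where
  "safe R \<longleftrightarrow>
     atom_vars (head R) \<subseteq> (\<Union>l\<in>set (body R). atom_vars (atom_of l)) \<and>
     (\<forall>A. Neg A \<in> set (body R) \<longrightarrow>
        atom_vars A \<subseteq> (\<Union>B\<in>{B. Pos B \<in> set (body R)}. atom_vars B))"

definition ifdatalog_program :: "('p, 'c, 'v, 'l::complete_lattice) program \<Rightarrow> bool" where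
  "ifdatalog_program P \<longleftrightarrow>
     finite P \<and> (\<forall>R\<in>P. safe R \<and> level R \<noteq> bot \<and> implication_operator (impl R))"

definition positive :: "('p, 'c, 'v, 'l) program \<Rightarrow> bool" where
  "positive P \<longleftrightarrow> (\<forall>R\<in>P. \<forall>A. Neg A \<notin> set (body R))"

definition herbrand_universe :: "('p, 'c, 'v, 'l) program \<Rightarrow> 'c set" where
  "herbrand_universe P = {c. \<exists>R\<in>P. \<exists>A\<in>rule_atoms R. Const c \<in> set (args A)}"

text \<open>A predicate symbol is a name together with its arity.\<close>

definition predicates :: "('p, 'c, 'v, 'l) program \<Rightarrow> ('p \<times> nat) set" where
  "predicates P = {(pred A, length (args A)) | A. \<exists>R\<in>P. A \<in> rule_atoms R}"

definition herbrand_base :: "('p, 'c, 'v, 'l) program \<Rightarrow> ('p, 'c) atom set" where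
  "herbrand_base P =
     {A. (pred A, length (args A)) \<in> predicates P \<and> set (args A) \<subseteq> herbrand_universe P}"

fun subst :: "('v \<Rightarrow> 'c) \<Rightarrow> ('c, 'v) trm \<Rightarrow> 'c" where
  "subst \<sigma> (Const c) = c"
| "subst \<sigma> (Var v) = \<sigma> v"

definition ground :: "('p, 'c, 'v, 'l) program \<Rightarrow> ('p, 'c, 'l) ground_rule set" where
  "ground P = {map_rule (map_atom id (subst \<sigma>)) R | \<sigma> R.
     R \<in> P \<and> (\<forall>A\<in>rule_atoms R. \<sigma> ` atom_vars A \<subseteq> herbrand_universe P)}"


text \<open>
  Interpretations are total functions, zero outside the Herbrand base; the order and the
  joins of the function type are the pointwise ones.
\<close>

type_synonym ('p, 'c, 'l) interp = "('p, 'c) atom \<Rightarrow> 'l"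

definition interpretation_of ::
    "('p, 'c, 'v, 'l::complete_lattice) program \<Rightarrow> ('p, 'c, 'l) interp \<Rightarrow> bool" where
  "interpretation_of P X \<longleftrightarrow> (\<forall>A. A \<notin> herbrand_base P \<longrightarrow> X A = bot)"

fun literal_level :: "('p, 'c, 'l::uminus) interp \<Rightarrow> ('p, 'c) atom literal \<Rightarrow> 'l" where
  "literal_level X (Pos A) = X A"
| "literal_level X (Neg A) = - X A"

definition body_occurs ::
    "('p, 'c, 'l::complete_lattice) interp \<Rightarrow> ('p, 'c, 'l) ground_rule \<Rightarrow> bool" where
  "body_occurs X R \<longleftrightarrow> (\<forall>l\<in>set (body R). X (atom_of l) \<noteq> bot)"

text \<open>The empty infimum gives facts the body level \<open>top\<close>.\<close>

definition body_level ::
    "('p, 'c, 'l::{complete_lattice, uminus}) interp \<Rightarrow> ('p, 'c, 'l) ground_rule \<Rightarrow> 'l" where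
  "body_level X R = (if body_occurs X R then (INF l\<in>set (body R). literal_level X l) else bot)"

definition model ::
    "('p, 'c, 'v, 'l::{complete_lattice, uminus}) program \<Rightarrow> ('p, 'c, 'l) interp \<Rightarrow> bool" where
  "model P X \<longleftrightarrow> interpretation_of P X \<and>
     (\<forall>R\<in>ground P. level R \<le> impl R (body_level X R) (X (head R)))"


definition head_level ::
    "('p, 'c, 'l::{complete_lattice, uminus}) interp \<Rightarrow> ('p, 'c, 'l) ground_rule \<Rightarrow> 'l" where
  "head_level X R = sup bot (uncertainty_level (impl R) (body_level X R) (level R))"

definition consequence ::
    "('p, 'c, 'l::{complete_lattice, uminus}) interp \<Rightarrow> ('p, 'c, 'l) ground_rule \<Rightarrow> ('p, 'c, 'l) interp"
  where "consequence X R = (\<lambda>_. bot)(head R := head_level X R)"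

definition iDT ::
    "('p, 'c, 'v, 'l::{complete_lattice, uminus}) program \<Rightarrow> ('p, 'c, 'l) interp \<Rightarrow> ('p, 'c, 'l) interp"
  where "iDT P X = sup (SUP R\<in>{R \<in> ground P. body_occurs X R}. consequence X R) X"

text \<open>\<open>iNT P X Y\<close> holds if \<open>Y\<close> is a possible result of the transformation on \<open>X\<close>.\<close>

definition iNT ::
    "('p, 'c, 'v, 'l::{complete_lattice, uminus}) program \<Rightarrow> ('p, 'c, 'l) interp \<Rightarrow> ('p, 'c, 'l) interp
       \<Rightarrow> bool" where
  "iNT P X Y \<longleftrightarrow> (\<exists>R\<in>ground P. body_occurs X R \<and> Y = sup (consequence X R) X)"

definition iDT_fixpoint ::
    "('p, 'c, 'v, 'l::{complete_lattice, uminus}) program \<Rightarrow> ('p, 'c, 'l) interp \<Rightarrow> bool" where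
  "iDT_fixpoint P X \<longleftrightarrow> interpretation_of P X \<and> iDT P X = X"

definition iNT_fixpoint ::
    "('p, 'c, 'v, 'l::{complete_lattice, uminus}) program \<Rightarrow> ('p, 'c, 'l) interp \<Rightarrow> bool" where
  "iNT_fixpoint P X \<longleftrightarrow> interpretation_of P X \<and> (\<forall>Y. iNT P X Y \<longrightarrow> Y = X)"

text \<open>The level of a fact does not depend on the interpretation it is evaluated in.\<close>

definition facts ::
    "('p, 'c, 'v, 'l::{complete_lattice, uminus}) program \<Rightarrow> ('p, 'c, 'l) interp" where
  "facts P = (SUP R\<in>{R \<in> ground P. body R = []}. consequence bot R)"


text \<open>
  \<open>X\<close> is a transfinite sequence indexed by the well-order \<open>r\<close>, with value \<open>x0\<close> at zero,
  a step at each successor index (\<open>under r j = underS r i\<close> says that \<open>i\<close> is the successor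
  of \<open>j\<close>), and the union of all earlier stages at each limit index.
\<close>

definition transfinite_run ::
    "'i rel \<Rightarrow> ('a \<Rightarrow> 'a \<Rightarrow> bool) \<Rightarrow> 'a \<Rightarrow> ('i \<Rightarrow> 'a::complete_lattice) \<Rightarrow> bool" where
  "transfinite_run r step x0 X \<longleftrightarrow> Well_order r \<and>
     (\<forall>i\<in>Field r.
        (underS r i = {} \<longrightarrow> X i = x0) \<and>
        (\<forall>j\<in>Field r. under r j = underS r i \<longrightarrow> step (X j) (X i)) \<and>
        (underS r i \<noteq> {} \<and> (\<forall>j\<in>Field r. under r j \<noteq> underS r i) \<longrightarrow> X i = (SUP j\<in>underS r i. X j)))"

text \<open>
  Indices are sets of stages: by Cantor's theorem this type carries well-orders too long for
  a strictly increasing sequence of stages, so no iteration is cut off too early.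
\<close>

definition reachable :: "('a \<Rightarrow> 'a \<Rightarrow> bool) \<Rightarrow> 'a \<Rightarrow> 'a::complete_lattice \<Rightarrow> bool" where
  "reachable step x0 x \<longleftrightarrow>
     (\<exists>(r :: 'a set rel) X. transfinite_run r step x0 X \<and> (\<exists>i\<in>Field r. X i = x))"

definition lfp_iDT ::
    "('p, 'c, 'v, 'l::{complete_lattice, uminus}) program \<Rightarrow> ('p, 'c, 'l) interp \<Rightarrow> bool" where
  "lfp_iDT P X \<longleftrightarrow> reachable (\<lambda>Y Z. Z = iDT P Y) (facts P) X \<and> iDT_fixpoint P X"

text \<open>
  With negation the fixed point reached may depend on the choice of the rules, hence a
  predicate rather than a function.
\<close>

definition lfp_iNT ::
    "('p, 'c, 'v, 'l::{complete_lattice, uminus}) program \<Rightarrow> ('p, 'c, 'l) interp \<Rightarrow> bool" where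
  "lfp_iNT P X \<longleftrightarrow> reachable (iNT P) (facts P) X \<and> iNT_fixpoint P X"

end

(*
  For programs whose implication operators have a well-defined uncertainty level, the condition
  level R <= impl R (body_level X R) (X (head R)) says exactly that head_level X R <= X (head R)
  (residuation); rules whose body does not occur have body level bot and hold vacuously. Hence,
  with or without negation, "fixed point of iDT", "fixed point of iNT" and "model" coincide.
  A fixed point is reached because an inflationary iteration that never stops would inject the
  index type, a power type, into the type of stages. The deterministic one is unique because its
  stages all belong to the Bourbaki-Witt tower. Without negation every rule application
  preserves being below a given model, so every fixed point reached is the least model.
*)
theory Submission
  imports Defs "HOL-Library.Bourbaki_Witt_Fixpoint"
begin

section \<open>Transfinite runs\<close>

text \<open>The definition of a run only asks for some \<open>j\<close> in the field whose
  \<open>under\<close> is \<open>underS r i\<close>. Reflexivity puts this \<open>j\<close> strictly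
  before \<open>i\<close>, where an induction hypothesis can reach it.\<close>

lemma transfinite_run_cases:
  assumes run: "transfinite_run r step x0 X" and i: "i \<in> Field r"
  obtains (zero) "underS r i = {}" "X i = x0"
    | (succ) j where "j \<in> underS r i" "under r j = underS r i" "step (X j) (X i)"
    | (limit) "underS r i \<noteq> {}" "X i = (SUP j\<in>underS r i. X j)"
proof (cases "\<exists>j\<in>Field r. under r j = underS r i")
  case True
  then obtain j where j: "j \<in> Field r" "under r j = underS r i" by blast
  have "Refl r"
    using run by (simp add: transfinite_run_def order_on_defs)
  then have "j \<in> under r j"
    using j(1) by (simp add: refl_on_def under_def)
  then show thesis
    using succ[of j] j run i unfolding transfinite_run_def by blast
next
  case False
  then show thesis
    using zero limit run i unfolding transfinite_run_def by blast
qed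

text \<open>Well-order induction on the later index. At a successor, every strictly earlier index is
  at or before the predecessor; at a limit, the earlier stage is a member of the join.\<close>

lemma transfinite_run_mono:
  assumes run: "transfinite_run r step x0 X"
    and incr: "\<And>x y. step x y \<Longrightarrow> x \<le> y"
    and ji: "(j, i) \<in> r"
  shows "X j \<le> X i"
proof -
  have wo: "wo_rel r"
    using run by (simp add: transfinite_run_def wo_rel_def)
  have "\<forall>j. (j, i) \<in> r \<longrightarrow> X j \<le> X i"
  proof (induction i rule: wo_rel.well_order_induct[OF wo])
    case (1 i)
    show ?case
    proof (intro allI impI)
      fix j
      assume ji: "(j, i) \<in> r"
      then have i: "i \<in> Field r" by (rule FieldI2)
      show "X j \<le> X i"
      proof (cases "j = i")
        case False
        then have j: "j \<in> underS r i" using ji by (simp add: underS_def)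
        from run i show ?thesis
        proof (cases rule: transfinite_run_cases)
          case (succ k)
          have "(j, k) \<in> r" using j succ(2) by (auto simp: under_def)
          then have "X j \<le> X k" using 1 succ(1) by (auto simp: underS_def)
          also have "X k \<le> X i" using succ(3) by (rule incr)
          finally show ?thesis .
        qed (use j in \<open>auto intro: SUP_upper\<close>)
      qed simp
    qed
  qed
  with ji show ?thesis by blast
qed

text \<open>The order as a set of pairs, the form expected by \<open>Chains\<close> and by the
  Bourbaki-Witt locale.\<close>

abbreviation le_rel :: "('a::order) rel" where
  "le_rel \<equiv> {(x, y). x \<le> y}"

lemma Field_le_rel [simp]: "Field le_rel = UNIV"
  by (auto simp: Field_def)

text \<open>Transfinite induction with the run hidden. The stages before a limit form a nonempty
  chain because steps only increase, so the cases match the introduction rules of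
  \<open>iterates_above\<close>.\<close>

lemma reachable_induct [consumes 1, case_names incr base step Sup]:
  fixes x0 :: "'a::complete_lattice"
  assumes x: "reachable step x0 x"
    and incr: "\<And>x y. step x y \<Longrightarrow> x \<le> y"
    and base: "Q x0"
    and step: "\<And>x y. Q x \<Longrightarrow> step x y \<Longrightarrow> Q y"
    and Sup: "\<And>M. M \<in> Chains le_rel \<Longrightarrow> M \<noteq> {} \<Longrightarrow> (\<And>y. y \<in> M \<Longrightarrow> Q y) \<Longrightarrow> Q (Sup M)"
  shows "Q x"
proof -
  obtain r :: "'a set rel" and X i
    where run: "transfinite_run r step x0 X" and i: "i \<in> Field r" and x: "x = X i"
    using x unfolding reachable_def by blast
  have wo: "wo_rel r"
    using run by (simp add: transfinite_run_def wo_rel_def)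
  have "i \<in> Field r \<longrightarrow> Q (X i)"
  proof (induction i rule: wo_rel.well_order_induct[OF wo])
    case (1 i)
    show ?case
    proof
      assume i: "i \<in> Field r"
      have IH: "Q (X j)" if "j \<in> underS r i" for j
        using 1 that by (auto simp: underS_def Field_def)
      from run i show "Q (X i)"
      proof (cases rule: transfinite_run_cases)
        case limit
        have "(j, k) \<in> r \<or> (k, j) \<in> r" if "j \<in> underS r i" "k \<in> underS r i" for j k
          using that wo_rel.in_notinI[OF wo, of k j] by (auto simp: underS_def Field_def)
        then have "X ` underS r i \<in> Chains le_rel"
          using transfinite_run_mono[OF run incr] by (auto simp: Chains_def)
        then show ?thesis
          unfolding limit(2) using limit(1) IH by (intro Sup) auto
      qed (use base step IH in auto)
    qed
  qed
  with i x show ?thesis by simp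
qed

section \<open>Existence and uniqueness of the fixed point reached\<close>

lemma not_inj_powerset: "\<not> inj (f :: 'a set \<Rightarrow> 'a)"
proof
  assume "inj f"
  then have "inv f ` UNIV = Pow UNIV"
    using inj_imp_surj_inv by simp
  then show False
    using Cantors_theorem[of UNIV] by blast
qed

text \<open>Here \<open>g\<close> selects one of the possible steps: it is \<open>iDT P\<close>
  itself or a choice of an effective rule. If no stage were fixed by \<open>g\<close>, the stages
  would increase strictly along a well-order of all of \<open>'a set\<close>, against
  Cantor.\<close>

lemma reachable_fixpoint_exists:
  fixes g :: "'a::complete_lattice \<Rightarrow> 'a"
  assumes incr: "\<And>x. x \<le> g x"
    and step: "\<And>x. g x \<noteq> x \<Longrightarrow> step x (g x)"
  shows "\<exists>x. reachable step x0 x \<and> g x = x"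
proof -
  obtain r :: "'a set rel" where r: "Well_order r" and field: "Field r = UNIV"
    using well_ordering[where ?'a = "'a set"] by (elim exE conjE)
  have wo: "wo_rel r" using r by (simp add: wo_rel_def)
  \<comment> \<open>One clause covers all three kinds of index, since \<open>g\<close> is inflationary.\<close>
  define F where "F h i = sup x0 (SUP j\<in>underS r i. g (h j))" for h :: "'a set \<Rightarrow> 'a" and i
  define X where "X = wfrec (r - Id) F"
  \<comment> \<open>\<open>F\<close> reads \<open>h\<close> only on \<open>underS r i\<close>, so
    the cut that \<open>wfrec\<close> makes at \<open>i\<close> has no effect.\<close>
  have X: "X i = sup x0 (SUP j\<in>underS r i. g (X j))" for i
  proof -
    have "X i = F (cut X (r - Id) i) i"
      unfolding X_def by (rule wfrec) (rule wo_rel.WF[OF wo])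
    also have "\<dots> = F X i"
      unfolding F_def
      by (intro arg_cong2[of _ _ _ _ sup] SUP_cong refl) (auto simp: cut_apply underS_def)
    finally show ?thesis unfolding F_def .
  qed
  have gX: "g (X j) \<le> X i" if "j \<in> underS r i" for i j
    unfolding X[of i] using that by (intro le_supI2 SUP_upper)
  have X_le: "X j \<le> X i" if "(j, i) \<in> r" for i j
    using that gX[of j i] order_trans[OF incr] by (cases "j = i") (auto simp: underS_def)
  have "\<exists>i. g (X i) = X i"
  proof (rule ccontr)
    assume nofix: "\<nexists>i. g (X i) = X i"
    have less: "X i < X j" if "i \<in> underS r j" for i j
      using nofix incr[of "X i"] gX[OF that] by (metis order_neq_le_trans order_less_le_trans)
    have "inj X"
    proof (rule injI, rule ccontr)
      fix i j
      assume eq: "X i = X j" and ne: "i \<noteq> j"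
      have "i \<in> underS r j \<or> j \<in> underS r i"
        using ne wo_rel.in_notinI[OF wo, of i j] field by (auto simp: underS_def)
      then show False using less[of i j] less[of j i] eq by auto
    qed
    then show False using not_inj_powerset by blast
  qed
  then obtain i where "i \<in> {i. g (X i) = X i}" by blast
  then obtain m where fixm: "g (X m) = X m"
    and min: "\<And>i. (i, m) \<in> r - Id \<Longrightarrow> g (X i) \<noteq> X i"
    by (rule wfE_min[OF wo_rel.WF[OF wo]]) blast
  \<comment> \<open>Before \<open>m\<close> every application of \<open>g\<close> really moves,
    hence is a legal \<open>step\<close>.\<close>
  have least: "g (X i) \<noteq> X i" if "i \<in> underS r m" for i
    using that by (intro min) (simp add: underS_def)
  \<comment> \<open>The run stops at the first fixed point: \<open>step\<close> may be impossible from there.\<close>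
  define s where "s = Restr r (under r m)"
  have s: "Well_order s" unfolding s_def using r by (rule Well_order_Restr)
  have Fs: "Field s = under r m"
    unfolding s_def using r wo_rel.under_ofilter[OF wo] by (rule Field_Restr_ofilter)
  have m: "m \<in> under r m"
    using wo_rel.REFL[OF wo] field by (simp add: under_def refl_on_def)
  have trans: "(i, k) \<in> r" if "(i, j) \<in> r" "(j, k) \<in> r" for i j k
    using wo_rel.TRANS[OF wo] that by (rule transD)
  have less: "i \<in> underS r k" if "(i, j) \<in> r" "j \<in> underS r k" for i j k
    using that trans antisymD[OF wo_rel.ANTISYM[OF wo]] unfolding underS_def by blast
  \<comment> \<open>\<open>under r m\<close> is downward closed, so the restriction leaves its
    initial segments unchanged.\<close>
  have under_s: "under s i = under r i" "underS s i = underS r i" if "i \<in> under r m" for i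
    using that trans unfolding s_def by (auto simp: under_def underS_def)
  have "transfinite_run s step x0 X"
    unfolding transfinite_run_def
  proof (intro conjI ballI s impI; (elim conjE)?)
    fix i
    assume i: "i \<in> Field s"
    then have us: "under s i = under r i" "underS s i = underS r i"
      using under_s Fs by auto
    show "X i = x0" if "underS s i = {}"
      using that X[of i] us by simp
    have x0: "x0 \<le> X j" for j by (subst X) simp
    show "step (X j) (X i)" if j: "j \<in> Field s" "under s j = underS s i" for j
    proof -
      have u: "under r j = underS r i" using j us under_s Fs by auto
      have ji: "j \<in> underS r i"
        using wo_rel.REFL[OF wo] field by (simp flip: u add: under_def refl_on_def)
      \<comment> \<open>The recursive clause collapses to its last term: for \<open>k\<close> before
        \<open>j\<close>, \<open>g (X k)\<close> is already below \<open>X j\<close>.\<close>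
      have "X i \<le> g (X j)"
      proof (subst X, intro sup_least SUP_least)
        show "x0 \<le> g (X j)" using x0 incr order_trans by blast
        fix k
        assume "k \<in> underS r i"
        then have kj: "(k, j) \<in> r" by (simp flip: u add: under_def)
        show "g (X k) \<le> g (X j)"
        proof (cases "k = j")
          case False
          then have "g (X k) \<le> X j" using kj by (intro gX) (simp add: underS_def)
          then show ?thesis using incr order_trans by blast
        qed simp
      qed
      then have "X i = g (X j)" using gX[OF ji] by (rule antisym)
      moreover have "j \<in> underS r m"
        using ji i Fs less trans unfolding under_def underS_def by blast
      ultimately show ?thesis using step[of "X j"] least by simp
    qed
    show "X i = (SUP j\<in>underS s i. X j)"
      if ne: "underS s i \<noteq> {}" and lim: "\<forall>j\<in>Field s. under s j \<noteq> underS s i"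
    proof (rule antisym)
      show "(SUP j\<in>underS s i. X j) \<le> X i"
        using X_le us by (auto intro!: SUP_least simp: underS_def)
      show "X i \<le> (SUP j\<in>underS s i. X j)"
      proof (subst X, intro sup_least SUP_least)
        obtain k where "k \<in> underS s i" using ne by blast
        then show "x0 \<le> (SUP j\<in>underS s i. X j)" using x0 by (rule SUP_upper2)
      next
        fix j
        assume j: "j \<in> underS r i"
        then have "j \<in> Field s"
          using i Fs trans[of j i m] by (auto simp: under_def underS_def)
        moreover have "under r j \<subseteq> underS r i"
          using less j unfolding under_def by blast
        \<comment> \<open>As \<open>j\<close> is not the predecessor of \<open>i\<close>, some
          \<open>k\<close> lies strictly between them; \<open>X k\<close> absorbs
          \<open>g (X j)\<close>.\<close>
        ultimately obtain k where k: "k \<in> underS r i" "k \<notin> under r j"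
          using lim us under_s Fs by blast
        then have "j \<in> underS r k"
          using wo_rel.in_notinI[OF wo, of k j] wo_rel.REFL[OF wo] field
          by (auto simp: under_def underS_def refl_on_def)
        then have "g (X j) \<le> X k" by (rule gX)
        also have "X k \<le> (SUP j\<in>underS s i. X j)" using k us by (auto intro: SUP_upper)
        finally show "g (X j) \<le> (SUP j\<in>underS s i. X j)" .
      qed
    qed
  qed
  then have "reachable step x0 (X m)"
    unfolding reachable_def using m Fs by blast
  with fixm show ?thesis by blast
qed

text \<open>Two runs may use different well-orders, so their stages cannot be matched index by
  index. Instead, of two elements of the tower over \<open>x0\<close> one is an iterate above the
  other, and nothing new lies above a fixed point.\<close>

lemma reachable_fixpoint_unique:
  fixes f :: "'a::complete_lattice \<Rightarrow> 'a"
  assumes incr: "\<And>x. x \<le> f x"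
    and x: "reachable (\<lambda>y z. z = f y) x0 x" "f x = x"
    and y: "reachable (\<lambda>y z. z = f y) x0 y" "f y = y"
  shows "x = y"
proof -
  interpret bourbaki_witt_fixpoint Sup le_rel f
  proof
    show "Partial_order le_rel"
      by (auto simp: order_on_defs refl_on_def trans_def antisym_def)
  qed (auto intro: Sup_least Sup_upper incr)
  have tower: "z \<in> iterates_above x0" if "reachable (\<lambda>y z. z = f y) x0 z" for z
    using that
    by (induction rule: reachable_induct) (auto intro: incr iterates_above.intros)
  have stuck: "w = z" if "w \<in> iterates_above z" "f z = z" for w z
    using that(1)
  proof induction
    case (Sup M)
    then have "M = {z}" by auto
    then show ?case by simp
  qed (simp_all add: that)
  show ?thesis
    using iterates_above_triangle[OF tower[OF x(1)] tower[OF y(1)]] stuck x(2) y(2) by auto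
qed

section \<open>Ground rules\<close>

lemma groundE:
  assumes "R \<in> ground P"
  obtains R' \<sigma> where "R' \<in> P" "R = map_rule (map_atom id (subst \<sigma>)) R'"
    "\<And>A. A \<in> rule_atoms R' \<Longrightarrow> \<sigma> ` atom_vars A \<subseteq> herbrand_universe P"
  using assms unfolding ground_def by blast

text \<open>Keeps every derived atom inside the Herbrand base, so that the stages are
  interpretations.\<close>

lemma head_ground_in_herbrand_base:
  assumes "R \<in> ground P"
  shows "head R \<in> herbrand_base P"
  using assms
proof (rule groundE)
  fix R' \<sigma>
  assume R': "R' \<in> P" and R: "R = map_rule (map_atom id (subst \<sigma>)) R'"
    and \<sigma>: "\<And>A. A \<in> rule_atoms R' \<Longrightarrow> \<sigma> ` atom_vars A \<subseteq> herbrand_universe P"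
  have h: "head R' \<in> rule_atoms R'" by (simp add: rule_atoms_def)
  have "subst \<sigma> t \<in> herbrand_universe P" if "t \<in> set (args (head R'))" for t
  proof (cases t)
    case (Const c)
    then show ?thesis using that h R' by (auto simp: herbrand_universe_def)
  next
    case (Var v)
    then show ?thesis using that \<sigma>[OF h] by (auto simp: atom_vars_def)
  qed
  then show ?thesis
    using R' h by (auto simp: R rule.map_sel atom.map_sel herbrand_base_def predicates_def)
qed

lemma positive_ground:
  assumes "positive P" "R \<in> ground P"
  shows "Neg A \<notin> set (body R)"
  using assms(2)
proof (rule groundE)
  fix R' \<sigma>
  assume "R' \<in> P" and R: "R = map_rule (map_atom id (subst \<sigma>)) R'"
  have "Neg A \<noteq> map_literal (map_atom id (subst \<sigma>)) l" if "l \<in> set (body R')" for l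
  proof (cases l)
    case (Neg B)
    then show ?thesis using that \<open>R' \<in> P\<close> assms(1) by (auto simp: positive_def)
  qed simp
  then show ?thesis unfolding R rule.map_sel set_map by blast
qed

text \<open>Both ingredients grow with the interpretation: atoms that occur keep occurring, and
  positive literals carry the level of their atom. A body that does not occur in \<open>X\<close>
  contributes \<open>bot\<close>.\<close>

lemma body_level_mono_positive:
  assumes "\<And>A. Neg A \<notin> set (body R)" "X \<le> Y"
  shows "body_level X R \<le> body_level Y R"
proof (cases "body_occurs X R")
  case True
  have "X A \<le> Y A" for A using assms(2) by (simp add: le_fun_def)
  then have "body_occurs Y R"
    using True unfolding body_occurs_def by (metis bot_unique)
  moreover have "literal_level X l \<le> literal_level Y l" if "l \<in> set (body R)" for l
  proof (cases l)
    case (Pos A)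
    then show ?thesis using assms(2) by (simp add: le_fun_def)
  next
    case (Neg A)
    then show ?thesis using that assms(1) by simp
  qed
  ultimately show ?thesis
    using True by (auto simp: body_level_def intro!: INF_mono)
qed (simp add: body_level_def)

text \<open>Residuation: as \<open>I\<close> increases in its second argument and a least solution
  exists, the solutions \<gamma> form the principal up-set of that least one.\<close>

lemma uncertainty_level_le_iff:
  assumes "implication_operator I" "uncertainty_level_defined I"
  shows "uncertainty_level I \<alpha> \<beta> \<le> \<gamma> \<longleftrightarrow> \<beta> \<le> I \<alpha> \<gamma>"
proof -
  obtain m where m: "is_least {\<gamma>. \<beta> \<le> I \<alpha> \<gamma>} m"
    using assms(2) unfolding uncertainty_level_defined_def by blast
  then have "uncertainty_level I \<alpha> \<beta> = m"
    unfolding uncertainty_level_def by (auto simp: is_least_def intro: Least_equality)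
  moreover have "\<beta> \<le> I \<alpha> \<gamma>" if "m \<le> \<gamma>"
    using m assms(1) that order_trans[of \<beta> "I \<alpha> m" "I \<alpha> \<gamma>"]
    by (auto simp: is_least_def implication_operator_def)
  ultimately show ?thesis using m by (auto simp: is_least_def)
qed

lemma consequence_le_iff: "consequence X R \<le> Y \<longleftrightarrow> head_level X R \<le> Y (head R)"
  by (auto simp: consequence_def le_fun_def)

section \<open>Consequence transformations\<close>

lemma iDT_increasing: "X \<le> iDT P X"
  by (simp add: iDT_def)

lemma iNT_increasing: "iNT P X Y \<Longrightarrow> X \<le> Y"
  by (auto simp: iNT_def)

text \<open>Transfers closure properties and upper bounds from \<open>iDT\<close> to single
  nondeterministic steps.\<close>

lemma iNT_le_iDT: "iNT P X Y \<Longrightarrow> Y \<le> iDT P X"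
  unfolding iNT_def iDT_def by (blast intro: SUP_upper sup_mono)

section \<open>Closure of the interpretations under the transformations\<close>

lemma interpretation_of_antimono:
  "interpretation_of P Y \<Longrightarrow> X \<le> Y \<Longrightarrow> interpretation_of P X"
  unfolding interpretation_of_def le_fun_def by (metis bot.extremum_uniqueI)

lemma interpretation_of_Sup:
  "(\<And>X. X \<in> M \<Longrightarrow> interpretation_of P X) \<Longrightarrow> interpretation_of P (Sup M)"
  by (auto simp: interpretation_of_def intro!: antisym SUP_least)

lemma interpretation_of_consequence:
  "R \<in> ground P \<Longrightarrow> interpretation_of P (consequence X R)"
  by (auto simp: interpretation_of_def consequence_def dest: head_ground_in_herbrand_base)

lemma interpretation_of_facts: "interpretation_of P (facts P)"
  unfolding facts_def by (intro interpretation_of_Sup) (auto intro: interpretation_of_consequence)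

lemma interpretation_of_iDT:
  assumes "interpretation_of P X"
  shows "interpretation_of P (iDT P X)"
proof -
  let ?C = "consequence X ` {R \<in> ground P. body_occurs X R}"
  have "interpretation_of P (Sup (insert X ?C))"
    using assms by (intro interpretation_of_Sup) (auto intro: interpretation_of_consequence)
  then show ?thesis by (simp add: iDT_def sup.commute)
qed

lemma reachable_iDT_interpretation_of:
  "reachable (\<lambda>Y Z. Z = iDT P Y) (facts P) X \<Longrightarrow> interpretation_of P X"
proof (induction rule: reachable_induct)
  case (Sup M)
  show ?case by (rule interpretation_of_Sup) (rule Sup)
qed (simp_all add: iDT_increasing interpretation_of_facts interpretation_of_iDT)

lemma reachable_iNT_interpretation_of:
  "reachable (iNT P) (facts P) X \<Longrightarrow> interpretation_of P X"
proof (induction rule: reachable_induct)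
  case (step X Y)
  then show ?case
    using interpretation_of_antimono interpretation_of_iDT iNT_le_iDT by blast
next
  case (Sup M)
  show ?case by (rule interpretation_of_Sup) (rule Sup)
qed (simp_all add: iNT_increasing interpretation_of_facts)

lemma iDT_le_iff:
  "iDT P X \<le> Y \<longleftrightarrow>
    X \<le> Y \<and> (\<forall>R\<in>ground P. body_occurs X R \<longrightarrow> head_level X R \<le> Y (head R))"
  by (auto simp: iDT_def SUP_le_iff consequence_le_iff)

text \<open>A join of consequences is below \<open>X\<close> exactly when each of them is, which is
  stability under every choice of a rule.\<close>

lemma iDT_fixpoint_iff_iNT_fixpoint: "iDT_fixpoint P X \<longleftrightarrow> iNT_fixpoint P X"
proof -
  have "iDT P X = X \<longleftrightarrow> iDT P X \<le> X"
    using iDT_increasing[of X P] by (auto intro: antisym)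
  also have "\<dots> \<longleftrightarrow> (\<forall>R\<in>ground P. body_occurs X R \<longrightarrow> consequence X R \<le> X)"
    by (simp add: iDT_le_iff consequence_le_iff)
  also have "\<dots> \<longleftrightarrow> (\<forall>Y. iNT P X Y \<longrightarrow> Y = X)"
    by (auto simp: iNT_def le_iff_sup)
  finally show ?thesis by (simp add: iDT_fixpoint_def iNT_fixpoint_def)
qed

lemma lfp_iDT_ex1: "\<exists>!D. lfp_iDT P D"
proof (rule ex_ex1I)
  obtain D where "reachable (\<lambda>Y Z. Z = iDT P Y) (facts P) D" "iDT P D = D"
    using reachable_fixpoint_exists[of "iDT P" "\<lambda>Y Z. Z = iDT P Y"] iDT_increasing by blast
  then show "\<exists>D. lfp_iDT P D"
    using reachable_iDT_interpretation_of by (auto simp: lfp_iDT_def iDT_fixpoint_def)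
next
  fix D D'
  assume "lfp_iDT P D" "lfp_iDT P D'"
  then show "D = D'"
    unfolding lfp_iDT_def iDT_fixpoint_def
    by (elim conjE) (rule reachable_fixpoint_unique[of "iDT P", OF iDT_increasing])
qed

lemma lfp_iNT_ex: "\<exists>N. lfp_iNT P N"
proof -
  \<comment> \<open>Rule applications without effect are skipped, so \<open>g\<close> stops only
    where no choice of a rule changes anything.\<close>
  define g where "g X = (if \<exists>Y. iNT P X Y \<and> Y \<noteq> X then SOME Y. iNT P X Y \<and> Y \<noteq> X else X)" for X
  have g: "iNT P X (g X) \<and> g X \<noteq> X" if "iNT P X Y" "Y \<noteq> X" for X Y
  proof -
    have ex: "\<exists>Y. iNT P X Y \<and> Y \<noteq> X" using that by blast
    then have "g X = (SOME Y. iNT P X Y \<and> Y \<noteq> X)" by (simp add: g_def)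
    then show ?thesis using someI_ex[OF ex] by simp
  qed
  have step: "iNT P X (g X)" if "g X \<noteq> X" for X
  proof -
    have "\<exists>Y. iNT P X Y \<and> Y \<noteq> X"
      using that unfolding g_def by (rule contrapos_np) (rule if_not_P)
    then show ?thesis using g by blast
  qed
  have "X \<le> g X" for X
    using iNT_increasing[OF step] by (cases "g X = X") simp_all
  then obtain N where N: "reachable (iNT P) (facts P) N" "g N = N"
    using reachable_fixpoint_exists[of g "iNT P"] step by blast
  moreover have "\<forall>Y. iNT P N Y \<longrightarrow> Y = N" using g N(2) by blast
  ultimately show ?thesis
    using reachable_iNT_interpretation_of unfolding lfp_iNT_def iNT_fixpoint_def by blast
qed

section \<open>Models\<close>

context
  fixes P :: "('p, 'c, 'v, 'l::{complete_lattice, uminus}) program"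
  assumes program: "ifdatalog_program P"
    and defined: "\<forall>R\<in>P. uncertainty_level_defined (impl R)"
begin

lemma ground_impl:
  assumes "R \<in> ground P"
  shows "implication_operator (impl R)" "uncertainty_level_defined (impl R)"
  using assms program defined
  by (auto elim!: groundE simp: rule.map_sel ifdatalog_program_def)

lemma head_level_le_iff:
  assumes "R \<in> ground P"
  shows "head_level X R \<le> \<gamma> \<longleftrightarrow> level R \<le> impl R (body_level X R) \<gamma>"
  using uncertainty_level_le_iff[OF ground_impl[OF assms]] by (simp add: head_level_def)

text \<open>The body level is \<open>bot\<close>, and \<open>I bot bot = top\<close> with
  monotonicity in the second argument forces \<open>I bot\<close> to be constantly
  \<open>top\<close>.\<close>

lemma rule_holds_if_not_body_occurs:
  assumes "R \<in> ground P" "\<not> body_occurs X R"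
  shows "level R \<le> impl R (body_level X R) \<gamma>"
proof -
  have "top \<le> impl R bot \<gamma>"
    using ground_impl(1)[OF assms(1)] unfolding implication_operator_def by (metis bot_least)
  then show ?thesis using assms(2) by (simp add: body_level_def top_unique)
qed

lemma iDT_fixpoint_iff_model: "iDT_fixpoint P X \<longleftrightarrow> model P X"
proof -
  have "iDT P X = X \<longleftrightarrow> iDT P X \<le> X"
    using iDT_increasing[of X P] by (auto intro: antisym)
  also have "\<dots> \<longleftrightarrow> (\<forall>R\<in>ground P. level R \<le> impl R (body_level X R) (X (head R)))"
    using rule_holds_if_not_body_occurs by (auto simp: iDT_le_iff head_level_le_iff)
  finally show ?thesis by (simp add: iDT_fixpoint_def model_def)
qed

lemma facts_le_model:
  assumes "model P M"
  shows "facts P \<le> M"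
  unfolding facts_def
proof (rule SUP_least)
  fix R
  assume R: "R \<in> {R \<in> ground P. body R = []}"
  \<comment> \<open>An empty body occurs in every interpretation, so both sides are the empty
    infimum.\<close>
  then have "body_level bot R = body_level M R"
    by (simp add: body_level_def body_occurs_def)
  then show "consequence bot R \<le> M"
    using assms R by (auto simp: consequence_le_iff head_level_le_iff model_def)
qed

text \<open>Passing from \<open>M\<close> down to \<open>X\<close> lowers the body level and so
  raises the implication, which is decreasing there. The model inequality of \<open>M\<close> thus
  holds for the body evaluated in \<open>X\<close>, and residuation bounds the derived head level by
  that of \<open>M\<close>.\<close>

lemma iDT_le_model:
  assumes "positive P" "model P M" "X \<le> M"
  shows "iDT P X \<le> M"
proof -
  have "head_level X R \<le> M (head R)" if R: "R \<in> ground P" for R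
  proof -
    have "body_level X R \<le> body_level M R"
      using positive_ground[OF assms(1) R] assms(3) by (rule body_level_mono_positive)
    then have "impl R (body_level M R) (M (head R)) \<le> impl R (body_level X R) (M (head R))"
      using ground_impl(1)[OF R] by (simp add: implication_operator_def)
    then show ?thesis
      using assms(2) R order_trans unfolding head_level_le_iff[OF R] model_def by blast
  qed
  with assms(3) show ?thesis by (simp add: iDT_le_iff)
qed

lemma reachable_iDT_le_model:
  assumes "positive P" "model P M" "reachable (\<lambda>Y Z. Z = iDT P Y) (facts P) X"
  shows "X \<le> M"
  using assms(3)
proof (induction rule: reachable_induct)
  case (Sup N)
  show ?case by (rule Sup_least) (rule Sup)
qed (simp_all add: iDT_increasing facts_le_model iDT_le_model assms)

lemma reachable_iNT_le_model:
  assumes "positive P" "model P M" "reachable (iNT P) (facts P) X"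
  shows "X \<le> M"
  using assms(3)
proof (induction rule: reachable_induct)
  case (step X Y)
  from step(2) have "Y \<le> iDT P X" by (rule iNT_le_iDT)
  also have "\<dots> \<le> M" using assms(1,2) step(1) by (rule iDT_le_model)
  finally show ?case .
next
  case (Sup N)
  show ?case by (rule Sup_least) (rule Sup)
qed (simp_all add: iNT_increasing facts_le_model assms)

text \<open>Stated for any complete lattice with a unary minus, to be instantiated with
  \<open>L_F\<close> and with \<open>L_V\<close>.\<close>

lemma lfp_iDT_iNT_properties:
  "(\<exists>!D. lfp_iDT P D) \<and> (\<exists>N. lfp_iNT P N) \<and>
    (\<forall>D N. lfp_iDT P D \<and> lfp_iNT P N \<longrightarrow>
       model P D \<and> model P N \<and>
       (positive P \<longrightarrow>
          D = N \<and>
          is_least {X. iDT_fixpoint P X} D \<and> is_least {X. iNT_fixpoint P X} D \<and>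
          is_least {X. model P X} D))"
proof -
  have iNT: "iNT_fixpoint P X \<longleftrightarrow> model P X" for X
    by (simp flip: iDT_fixpoint_iff_model iDT_fixpoint_iff_iNT_fixpoint)
  \<comment> \<open>Each of \<open>D\<close> and \<open>N\<close> is a model and lies below every
    model, in particular below the other.\<close>
  have "D = N" if "positive P" "lfp_iDT P D" "lfp_iNT P N" for D N
    using that reachable_iDT_le_model reachable_iNT_le_model
    by (intro antisym) (auto simp: lfp_iDT_def lfp_iNT_def iDT_fixpoint_iff_model iNT)
  then show ?thesis
    using lfp_iDT_ex1[of P] lfp_iNT_ex[of P] reachable_iDT_le_model
    by (auto simp: is_least_def lfp_iDT_def lfp_iNT_def iDT_fixpoint_iff_model iNT)
qed

end

theorem theorem4:
  fixes P_F :: "('p, 'c, 'v, L_F) program"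
    and P_V :: "('p, 'c, 'v, L_V) program"
  shows
    "(ifdatalog_program P_F \<and> (\<forall>R\<in>P_F. uncertainty_level_defined (impl R)) \<longrightarrow>
        (\<exists>!D. lfp_iDT P_F D) \<and> (\<exists>N. lfp_iNT P_F N) \<and>
        (\<forall>D N. lfp_iDT P_F D \<and> lfp_iNT P_F N \<longrightarrow>
           model P_F D \<and> model P_F N \<and>
           (positive P_F \<longrightarrow>
              D = N \<and>
              is_least {X. iDT_fixpoint P_F X} D \<and> is_least {X. iNT_fixpoint P_F X} D \<and>
              is_least {X. model P_F X} D)))
     \<and>
     (ifdatalog_program P_V \<and> (\<forall>R\<in>P_V. uncertainty_level_defined (impl R)) \<longrightarrow>
        (\<exists>!D. lfp_iDT P_V D) \<and> (\<exists>N. lfp_iNT P_V N) \<and>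
        (\<forall>D N. lfp_iDT P_V D \<and> lfp_iNT P_V N \<longrightarrow>
           model P_V D \<and> model P_V N \<and>
           (positive P_V \<longrightarrow>
              D = N \<and>
              is_least {X. iDT_fixpoint P_V X} D \<and> is_least {X. iNT_fixpoint P_V X} D \<and>
              is_least {X. model P_V X} D)))"
  by (rule conjI; rule impI; elim conjE; rule lfp_iDT_iNT_properties; assumption)

end
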